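(* Let $V$ be a vector space over a field and let $f\in L(V)$. Then $f$ is unit-regular in $L(V)$ if and only if $\operatorname{nullity}(f)=\operatorname{corank}(f)$.
   Context: $L(V)$ is the semigroup of all linear maps $V\to V$ under composition. An element $s$ of a semigroup $S$ with identity is unit-regular in $S$ if there is a unit $u$ of $S$ with $sus=s$. $\operatorname{nullity}(f)$ is the dimension of the null space of $f$, and $\operatorname{corank}(f)=\dim(V/R(f))$, where $R(f)$ is the range of $f$. $V$ may be infinite-dimensional; dimensions are cardinal numbers. *)

theory Defs
  imports "HOL-Algebra.Algebraic_Closure_Type"
begin

unbundle cardinal_syntax

section \<open>Dimension of a module, as a cardinal\<close>

definition lin_indep :: "('k, 'm) ring_scheme \<Rightarrow> ('k, 'v, 'n) module_scheme \<Rightarrow> 'v set \<Rightarrow> bool"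
  where "lin_indep R M B \<longleftrightarrow> B \<subseteq> carrier M \<and>
    (\<forall>A c. finite A \<and> A \<subseteq> B \<and> c \<in> A \<rightarrow> carrier R \<and>
       (\<Oplus>\<^bsub>M\<^esub>v\<in>A. c v \<odot>\<^bsub>M\<^esub> v) = \<zero>\<^bsub>M\<^esub> \<longrightarrow> (\<forall>v\<in>A. c v = \<zero>\<^bsub>R\<^esub>))"

definition lin_span :: "('k, 'm) ring_scheme \<Rightarrow> ('k, 'v, 'n) module_scheme \<Rightarrow> 'v set \<Rightarrow> 'v set"
  where "lin_span R M B =
    {(\<Oplus>\<^bsub>M\<^esub>v\<in>A. c v \<odot>\<^bsub>M\<^esub> v) | A c. finite A \<and> A \<subseteq> B \<and> c \<in> A \<rightarrow> carrier R}"

definition is_basis :: "('k, 'm) ring_scheme \<Rightarrow> ('k, 'v, 'n) module_scheme \<Rightarrow> 'v set \<Rightarrow> bool"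
  where "is_basis R M B \<longleftrightarrow> lin_indep R M B \<and> lin_span R M B = carrier M"

text \<open>The dimension is the cardinal of a basis. Cardinals are represented as in the library, by
  well-orders of least type, and are to be compared by \<open>=o\<close>, which may relate
  cardinals over different types. As for the library's \<open>dim\<close>, the choice of the basis
  is left to Hilbert choice; over a field it exists and its cardinal does not depend on the choice.\<close>

definition vs_dim :: "('k, 'm) ring_scheme \<Rightarrow> ('k, 'v, 'n) module_scheme \<Rightarrow> 'v rel"
  where "vs_dim R M = |SOME B. is_basis R M B|"


section \<open>Quotient modules\<close>

text \<open>The ring fields \<open>mult\<close> and \<open>one\<close> of a module record play no role for modules.\<close>

definition quotient_module :: "('k, 'v, 'n) module_scheme \<Rightarrow> 'v set \<Rightarrow> ('k, 'v set) module"
  where "quotient_module M H =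
    \<lparr>carrier = a_rcosets\<^bsub>M\<^esub> H, monoid.mult = undefined, one = undefined, zero = H, add = set_add M,
     module.smult = (\<lambda>c C. \<Union>x\<in>C. H +>\<^bsub>M\<^esub> (c \<odot>\<^bsub>M\<^esub> x))\<rparr>"

lemma (in module) quotient_smult:
  assumes H: "submodule H R M" and c: "c \<in> carrier R" and x: "x \<in> carrier M"
  shows "c \<odot>\<^bsub>quotient_module M H\<^esub> (H +>\<^bsub>M\<^esub> x) = H +>\<^bsub>M\<^esub> (c \<odot>\<^bsub>M\<^esub> x)"
proof -
  interpret H: submodule H R M by (rule H)
  have sub: "subgroup H (add_monoid M)" by (rule H.subgroup_axioms)
  interpret A: abelian_subgroup H M
    by (rule abelian_subgroupI3) (auto simp: additive_subgroup_def sub M.abelian_group_axioms)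
  have "H +>\<^bsub>M\<^esub> (c \<odot>\<^bsub>M\<^esub> y) = H +>\<^bsub>M\<^esub> (c \<odot>\<^bsub>M\<^esub> x)" if y: "y \<in> H +>\<^bsub>M\<^esub> x" for y
  proof -
    obtain h where h: "h \<in> H" "y = h \<oplus>\<^bsub>M\<^esub> x"
      using y unfolding a_r_coset_def' by blast
    have "c \<odot>\<^bsub>M\<^esub> y = c \<odot>\<^bsub>M\<^esub> h \<oplus>\<^bsub>M\<^esub> c \<odot>\<^bsub>M\<^esub> x"
      using h c x A.a_Hcarr by (simp add: smult_r_distr)
    hence "c \<odot>\<^bsub>M\<^esub> y \<in> H +>\<^bsub>M\<^esub> (c \<odot>\<^bsub>M\<^esub> x)"
      using h c unfolding a_r_coset_def' by blast
    thus ?thesis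
      using c x by (metis A.a_repr_independence' smult_closed)
  qed
  hence "(\<Union>y\<in>H +>\<^bsub>M\<^esub> x. H +>\<^bsub>M\<^esub> (c \<odot>\<^bsub>M\<^esub> y)) = H +>\<^bsub>M\<^esub> (c \<odot>\<^bsub>M\<^esub> x)"
    using A.a_rcos_self[OF x] by blast
  thus ?thesis by (simp add: quotient_module_def)
qed

lemma (in module) quotient_module_is_module:
  assumes H: "submodule H R M"
  shows "module R (quotient_module M H)"
proof -
  let ?Q = "quotient_module M H"
  interpret H: submodule H R M by (rule H)
  interpret A: abelian_subgroup H M
    by (rule abelian_subgroupI3)
       (auto simp: additive_subgroup_def H.subgroup_axioms M.abelian_group_axioms)
  have add: "(H +>\<^bsub>M\<^esub> x) \<oplus>\<^bsub>?Q\<^esub> (H +>\<^bsub>M\<^esub> y) = H +>\<^bsub>M\<^esub> (x \<oplus>\<^bsub>M\<^esub> y)"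
    if "x \<in> carrier M" "y \<in> carrier M" for x y
    using A.a_rcos_sum[OF that] by (simp add: quotient_module_def)
  have cosetE: "\<exists>x\<in>carrier M. C = H +>\<^bsub>M\<^esub> x" if "C \<in> carrier ?Q" for C
    using that by (auto simp: quotient_module_def A_RCOSETS_def')
  have cosetI: "H +>\<^bsub>M\<^esub> x \<in> carrier ?Q" if "x \<in> carrier M" for x
    using that by (auto simp: quotient_module_def A_RCOSETS_def')
  note sm = quotient_smult[OF H]
  show ?thesis
  proof (rule moduleI)
    show "cring R" by (rule R.is_cring)
    have zero: "\<zero>\<^bsub>?Q\<^esub> = H +>\<^bsub>M\<^esub> \<zero>\<^bsub>M\<^esub>"
      using A.a_subset by (simp add: quotient_module_def M.a_coset_add_zero)
    show "abelian_group ?Q"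
    proof (rule abelian_groupI)
      fix C D assume C: "C \<in> carrier ?Q" and D: "D \<in> carrier ?Q"
      show "C \<oplus>\<^bsub>?Q\<^esub> D \<in> carrier ?Q"
        using cosetE[OF C] cosetE[OF D] by (auto simp: add cosetI)
      show "C \<oplus>\<^bsub>?Q\<^esub> D = D \<oplus>\<^bsub>?Q\<^esub> C"
        using cosetE[OF C] cosetE[OF D] by (auto simp: add M.a_comm)
      fix E assume E: "E \<in> carrier ?Q"
      show "C \<oplus>\<^bsub>?Q\<^esub> D \<oplus>\<^bsub>?Q\<^esub> E = C \<oplus>\<^bsub>?Q\<^esub> (D \<oplus>\<^bsub>?Q\<^esub> E)"
        using cosetE[OF C] cosetE[OF D] cosetE[OF E] by (auto simp: add M.a_assoc)
    next
      show "\<zero>\<^bsub>?Q\<^esub> \<in> carrier ?Q" by (simp add: zero cosetI)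
    next
      fix C assume C: "C \<in> carrier ?Q"
      then obtain x where x: "x \<in> carrier M" "C = H +>\<^bsub>M\<^esub> x" using cosetE by blast
      show "\<zero>\<^bsub>?Q\<^esub> \<oplus>\<^bsub>?Q\<^esub> C = C"
        using add[OF M.zero_closed x(1)] x unfolding zero by simp
      have "(H +>\<^bsub>M\<^esub> (\<ominus>\<^bsub>M\<^esub> x)) \<oplus>\<^bsub>?Q\<^esub> C = \<zero>\<^bsub>?Q\<^esub>"
        unfolding zero x(2) using add[of "\<ominus>\<^bsub>M\<^esub> x" x] x(1) by (simp add: M.l_neg)
      thus "\<exists>D\<in>carrier ?Q. D \<oplus>\<^bsub>?Q\<^esub> C = \<zero>\<^bsub>?Q\<^esub>"
        using cosetI[of "\<ominus>\<^bsub>M\<^esub> x"] x(1) by (blast intro: M.a_inv_closed)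
    qed
  next
    fix a C assume a: "a \<in> carrier R" and C: "C \<in> carrier ?Q"
    show "a \<odot>\<^bsub>?Q\<^esub> C \<in> carrier ?Q" using a cosetE[OF C] by (auto simp: sm cosetI)
  next
    fix a b C assume "a \<in> carrier R" "b \<in> carrier R" and C: "C \<in> carrier ?Q"
    thus "(a \<oplus>\<^bsub>R\<^esub> b) \<odot>\<^bsub>?Q\<^esub> C = a \<odot>\<^bsub>?Q\<^esub> C \<oplus>\<^bsub>?Q\<^esub> b \<odot>\<^bsub>?Q\<^esub> C"
      using cosetE[OF C] by (auto simp: sm add smult_l_distr)
  next
    fix a C D assume "a \<in> carrier R" and C: "C \<in> carrier ?Q" and D: "D \<in> carrier ?Q"
    thus "a \<odot>\<^bsub>?Q\<^esub> (C \<oplus>\<^bsub>?Q\<^esub> D) = a \<odot>\<^bsub>?Q\<^esub> C \<oplus>\<^bsub>?Q\<^esub> a \<odot>\<^bsub>?Q\<^esub> D"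
      using cosetE[OF C] cosetE[OF D] by (auto simp: sm add smult_r_distr)
  next
    fix a b C assume "a \<in> carrier R" "b \<in> carrier R" and C: "C \<in> carrier ?Q"
    thus "(a \<otimes>\<^bsub>R\<^esub> b) \<odot>\<^bsub>?Q\<^esub> C = a \<odot>\<^bsub>?Q\<^esub> (b \<odot>\<^bsub>?Q\<^esub> C)"
      using cosetE[OF C] by (auto simp: sm smult_assoc1)
  next
    fix C assume C: "C \<in> carrier ?Q"
    thus "\<one>\<^bsub>R\<^esub> \<odot>\<^bsub>?Q\<^esub> C = C" using cosetE[OF C] by (auto simp: sm)
  qed
qed


section \<open>Linear maps, nullity and corank\<close>

definition module_of_type :: "('k \<Rightarrow> 'v \<Rightarrow> 'v) \<Rightarrow> ('k, 'v :: ab_group_add) module"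
  where "module_of_type scale =
    \<lparr>carrier = UNIV, monoid.mult = undefined, one = undefined, zero = 0, add = (+), module.smult = scale\<rparr>"

definition nullity :: "('k :: field \<Rightarrow> 'v \<Rightarrow> 'v) \<Rightarrow> ('v \<Rightarrow> 'v :: ab_group_add) \<Rightarrow> 'v rel"
  where "nullity scale f =
    vs_dim (ring_of_type_algebra :: 'k ring) ((module_of_type scale)\<lparr>carrier := {v. f v = 0}\<rparr>)"

definition corank :: "('k :: field \<Rightarrow> 'v \<Rightarrow> 'v) \<Rightarrow> ('v \<Rightarrow> 'v :: ab_group_add) \<Rightarrow> 'v set rel"
  where "corank scale f =
    vs_dim (ring_of_type_algebra :: 'k ring) (quotient_module (module_of_type scale) (range f))"

definition linear_maps :: "('k :: field \<Rightarrow> 'v \<Rightarrow> 'v) \<Rightarrow> ('v \<Rightarrow> 'v :: ab_group_add) monoid"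
  where "linear_maps scale =
    \<lparr>carrier = {f. Vector_Spaces.linear scale scale f}, monoid.mult = (\<circ>), one = id\<rparr>"

definition unit_regular :: "('a, 'm) monoid_scheme \<Rightarrow> 'a \<Rightarrow> bool"
  where "unit_regular S s \<longleftrightarrow>
    s \<in> carrier S \<and> (\<exists>u\<in>Units S. s \<otimes>\<^bsub>S\<^esub> u \<otimes>\<^bsub>S\<^esub> s = s)"

lemma module_module_of_type:
  assumes "vector_space scale"
  shows "module (ring_of_type_algebra :: 'k :: field ring) (module_of_type scale)"
proof -
  interpret vector_space scale by (rule assms)
  show ?thesis
  proof (rule moduleI)
    show "cring (ring_of_type_algebra :: 'k ring)"
      by (rule cring_from_type_algebra)
    show "abelian_group (module_of_type scale)"
    proof (rule abelian_groupI)
      fix x assume "x \<in> carrier (module_of_type scale)"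
      show "\<exists>y\<in>carrier (module_of_type scale).
              y \<oplus>\<^bsub>module_of_type scale\<^esub> x = \<zero>\<^bsub>module_of_type scale\<^esub>"
        by (rule bexI[of _ "- x"]) (simp_all add: module_of_type_def)
    qed (simp_all add: module_of_type_def algebra_simps)
  qed (simp_all add: module_of_type_def ring_of_type_algebra_def scale_left_distrib scale_right_distrib)
qed

lemma monoid_linear_maps:
  assumes "vector_space scale"
  shows "monoid (linear_maps scale)"
  by (rule monoidI)
     (simp_all add: linear_maps_def vector_space.linear_id[OF assms] Vector_Spaces.linear_compose comp_assoc)

end

theory Submission
  imports Defs
begin

text \<open>If \<open>f u f = f\<close> for a linear bijection \<open>u\<close> with inverse \<open>w\<close>, then \<open>f u\<close> is a projection onto the
  range of \<open>f\<close> and \<open>w\<close> maps the null space of \<open>f\<close> onto the null space of \<open>f u\<close>, a complement of the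
  range. Conversely, let \<open>p\<close> be a projection onto the range of \<open>f\<close>, let \<open>g\<close> be linear with
  \<open>f (g y) = y\<close> on the range, and let \<open>h\<close> map the null space of \<open>p\<close> isomorphically onto that of \<open>f\<close>;
  then \<open>u v = g (p v) + h (v - p v)\<close> is the required unit.\<close>

context vector_space
begin

section \<open>Transport of linear combinations, bases and dimension along an isomorphism\<close>

text \<open>Bridge between type-class sums and \<open>finsum\<close> in a module record, by
  induction on \<open>A\<close>; injectivity of \<phi> keeps the image of a new vector distinct from
  the earlier images.\<close>

lemma finsum_iso:
  assumes "abelian_monoid N" and W: "subspace W"
    and bij: "bij_betw \<phi> W (carrier N)"
    and zero: "\<phi> 0 = \<zero>\<^bsub>N\<^esub>"
    and add: "\<And>x y. x \<in> W \<Longrightarrow> y \<in> W \<Longrightarrow> \<phi> (x + y) = \<phi> x \<oplus>\<^bsub>N\<^esub> \<phi> y"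
    and smult: "\<And>a x. x \<in> W \<Longrightarrow> \<phi> (a *s x) = a \<odot>\<^bsub>N\<^esub> \<phi> x"
    and "finite A" "A \<subseteq> W"
  shows "(\<Oplus>\<^bsub>N\<^esub>w\<in>\<phi> ` A. c w \<odot>\<^bsub>N\<^esub> w) = \<phi> (\<Sum>v\<in>A. c (\<phi> v) *s v)"
  using assms(7,8)
proof (induction A)
  case empty
  interpret abelian_monoid N by fact
  show ?case by (simp add: zero)
next
  case (insert a A)
  interpret abelian_monoid N by fact
  \<comment> \<open>Closure of \<open>N\<close> under scalars is borrowed from \<open>W\<close>
    through \<phi>.\<close>
  have carr: "c (\<phi> x) \<odot>\<^bsub>N\<^esub> \<phi> x \<in> carrier N" if "x \<in> W" for x
    using smult[OF that] subspace_scale[OF W that] bij_betwE[OF bij] by metis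
  have notin: "\<phi> a \<notin> \<phi> ` A"
    using insert bij by (auto simp: bij_betw_def inj_on_def)
  have "(\<Oplus>\<^bsub>N\<^esub>w\<in>\<phi> ` insert a A. c w \<odot>\<^bsub>N\<^esub> w)
      = c (\<phi> a) \<odot>\<^bsub>N\<^esub> \<phi> a \<oplus>\<^bsub>N\<^esub> (\<Oplus>\<^bsub>N\<^esub>w\<in>\<phi> ` A. c w \<odot>\<^bsub>N\<^esub> w)"
    using insert.hyps insert.prems notin carr unfolding image_insert by (intro finsum_insert) auto
  also have "\<dots> = \<phi> (c (\<phi> a) *s a + (\<Sum>v\<in>A. c (\<phi> v) *s v))"
    using insert by (subst add) (auto simp: smult intro!: subspace_sum subspace_scale W)
  finally show ?case using insert.hyps by simp
qed

text \<open>Finite subsets of the image of \<open>B\<close> are images of finite subsets of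
  \<open>B\<close>, so by \<open>finsum_iso\<close> linear combinations, and with them span and
  independence, correspond on both sides.\<close>

lemma is_basis_iso_iff:
  assumes N: "abelian_monoid N" and W: "subspace W"
    and bij: "bij_betw \<phi> W (carrier N)"
    and zero: "\<phi> 0 = \<zero>\<^bsub>N\<^esub>"
    and add: "\<And>x y. x \<in> W \<Longrightarrow> y \<in> W \<Longrightarrow> \<phi> (x + y) = \<phi> x \<oplus>\<^bsub>N\<^esub> \<phi> y"
    and smult: "\<And>a x. x \<in> W \<Longrightarrow> \<phi> (a *s x) = a \<odot>\<^bsub>N\<^esub> \<phi> x"
    and B: "B \<subseteq> W"
  shows "is_basis (ring_of_type_algebra :: 'a ring) N (\<phi> ` B) \<longleftrightarrow> independent B \<and> span B = W"
proof -
  let ?R = "ring_of_type_algebra :: 'a ring"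
  let ?\<psi> = "inv_into W \<phi>"
  have R: "carrier ?R = UNIV" "\<zero>\<^bsub>?R\<^esub> = 0"
    by (simp_all add: ring_of_type_algebra_def)
  have inj: "inj_on \<phi> W" using bij by (rule bij_betw_imp_inj_on)
  have \<psi>: "?\<psi> (\<phi> x) = x" if "x \<in> W" for x
    using that inj by simp
  have fin: "(\<Oplus>\<^bsub>N\<^esub>w\<in>\<phi> ` A. c w \<odot>\<^bsub>N\<^esub> w) = \<phi> (\<Sum>v\<in>A. c (\<phi> v) *s v)"
    if "finite A" "A \<subseteq> B" for A c
    using that B by (intro finsum_iso[OF N W bij zero add smult]) auto
  \<comment> \<open>Reading coefficients back through \<open>?\<psi>\<close> realises an arbitrary
    family on \<open>A\<close> as a family on its image.\<close>
  have fin': "(\<Oplus>\<^bsub>N\<^esub>w\<in>\<phi> ` A. c (?\<psi> w) \<odot>\<^bsub>N\<^esub> w) = \<phi> (\<Sum>v\<in>A. c v *s v)"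
    if "finite A" "A \<subseteq> B" for A c
    using that B by (subst fin) (auto intro!: arg_cong[where f = \<phi>] sum.cong simp: \<psi> subset_iff)
  have sumW: "(\<Sum>v\<in>A. c v *s v) \<in> W" if "A \<subseteq> B" for A c
    using that B W by (intro subspace_sum subspace_scale) auto
  have subset: "\<exists>A. finite A \<and> A \<subseteq> B \<and> A' = \<phi> ` A" if "finite A'" "A' \<subseteq> \<phi> ` B" for A'
    using finite_subset_image[OF that] by blast
  have "lin_span ?R N (\<phi> ` B) = \<phi> ` span B"
  proof (intro equalityI subsetI)
    fix y assume "y \<in> lin_span ?R N (\<phi> ` B)"
    then obtain A' c where A': "finite A'" "A' \<subseteq> \<phi> ` B"
      and "y = (\<Oplus>\<^bsub>N\<^esub>w\<in>A'. c w \<odot>\<^bsub>N\<^esub> w)"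
      unfolding lin_span_def by auto
    with subset[OF A'] obtain A where A: "finite A" "A \<subseteq> B"
      and y: "y = (\<Oplus>\<^bsub>N\<^esub>w\<in>\<phi> ` A. c w \<odot>\<^bsub>N\<^esub> w)"
      by auto
    show "y \<in> \<phi> ` span B"
      unfolding y fin[OF A] using A by (intro imageI span_sum span_scale span_base) auto
  next
    fix y assume "y \<in> \<phi> ` span B"
    then obtain A c where A: "finite A" "A \<subseteq> B" and y: "y = \<phi> (\<Sum>v\<in>A. c v *s v)"
      unfolding span_explicit by blast
    show "y \<in> lin_span ?R N (\<phi> ` B)"
      unfolding lin_span_def y fin'[OF A, symmetric] R mem_Collect_eq using A
      by (intro exI[of _ "\<phi> ` A"] exI[of _ "\<lambda>w. c (?\<psi> w)"]) auto
  qed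
  \<comment> \<open>Both sets lie in \<open>W\<close>, where \<phi> is injective, so the images can
    be cancelled.\<close>
  moreover have "\<phi> ` span B = carrier N \<longleftrightarrow> span B = W"
    using span_minimal[OF B W] inj bij_betw_imp_surj_on[OF bij]
    by (metis inj_on_image_eq_iff order_refl)
  moreover have "lin_indep ?R N (\<phi> ` B) \<longleftrightarrow> independent B"
  proof
    assume L: "lin_indep ?R N (\<phi> ` B)"
    show "independent B"
      unfolding independent_explicit_module
    proof (intro allI impI)
      fix A c v assume A: "finite A" "A \<subseteq> B" and s: "(\<Sum>v\<in>A. c v *s v) = 0" and v: "v \<in> A"
      have "(\<Oplus>\<^bsub>N\<^esub>w\<in>\<phi> ` A. c (?\<psi> w) \<odot>\<^bsub>N\<^esub> w) = \<zero>\<^bsub>N\<^esub>"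
        unfolding fin'[OF A] s by (rule zero)
      moreover have "finite (\<phi> ` A)" "\<phi> ` A \<subseteq> \<phi> ` B" "(\<lambda>w. c (?\<psi> w)) \<in> \<phi> ` A \<rightarrow> carrier ?R"
        using A R by auto
      ultimately have "\<forall>w\<in>\<phi> ` A. c (?\<psi> w) = \<zero>\<^bsub>?R\<^esub>"
        using L unfolding lin_indep_def by simp
      moreover have "v \<in> W" using v A B by blast
      ultimately show "c v = 0" using v \<psi>[of v] R by auto
    qed
  next
    assume I: "independent B"
    have zero_coeffs: "\<forall>w\<in>A'. c w = 0" if A': "finite A'" "A' \<subseteq> \<phi> ` B"
      and s: "(\<Oplus>\<^bsub>N\<^esub>w\<in>A'. c w \<odot>\<^bsub>N\<^esub> w) = \<zero>\<^bsub>N\<^esub>" for A' c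
    proof -
      obtain A where A: "finite A" "A \<subseteq> B" "A' = \<phi> ` A" using subset[OF A'] by blast
      have "\<phi> (\<Sum>v\<in>A. c (\<phi> v) *s v) = \<phi> 0"
        using s unfolding A(3) fin[OF A(1,2)] zero .
      then have "(\<Sum>v\<in>A. c (\<phi> v) *s v) = 0"
        by (rule inj_onD[OF inj _ sumW[OF A(2)] subspace_0[OF W]])
      then have "\<forall>v\<in>A. c (\<phi> v) = 0"
        using I[unfolded independent_explicit_module, rule_format, OF A(1,2)] by (intro ballI)
      then show ?thesis using A(3) by blast
    qed
    show "lin_indep ?R N (\<phi> ` B)"
      using image_mono[OF B, of \<phi>] bij_betw_imp_surj_on[OF bij] unfolding lin_indep_def R
      by (intro conjI allI impI zero_coeffs) auto
  qed
  ultimately show ?thesis unfolding is_basis_def by simp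
qed

lemma bases_equinumerous:
  assumes "independent B" "independent C" "span B = span C"
  shows "|B| =o |C|"
  using bij_if_span_eq_span_bases[OF assms] card_of_ordIsoI by blast

text \<open>\<open>vs_dim\<close> uses a basis picked by Hilbert choice. The image of
  \<open>B\<close> shows that one exists; the chosen one pulls back to a basis of
  \<open>span B\<close>, and any two bases of a span are equinumerous.\<close>

lemma vs_dim_iso:
  assumes N: "abelian_monoid N"
    and bij: "bij_betw \<phi> (span B) (carrier N)"
    and zero: "\<phi> 0 = \<zero>\<^bsub>N\<^esub>"
    and add: "\<And>x y. x \<in> span B \<Longrightarrow> y \<in> span B \<Longrightarrow> \<phi> (x + y) = \<phi> x \<oplus>\<^bsub>N\<^esub> \<phi> y"
    and smult: "\<And>a x. x \<in> span B \<Longrightarrow> \<phi> (a *s x) = a \<odot>\<^bsub>N\<^esub> \<phi> x"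
    and B: "independent B"
  shows "vs_dim (ring_of_type_algebra :: 'a ring) N =o |B|"
proof -
  let ?R = "ring_of_type_algebra :: 'a ring"
  let ?S = "SOME S. is_basis ?R N S"
  have iff: "is_basis ?R N (\<phi> ` C) \<longleftrightarrow> independent C \<and> span C = span B" if "C \<subseteq> span B" for C
    using N subspace_span bij zero add smult that by (rule is_basis_iso_iff)
  have "is_basis ?R N (\<phi> ` B)" using B iff span_superset by blast
  then have S: "is_basis ?R N ?S" by (rule someI)
  then have "?S \<subseteq> \<phi> ` span B"
    using bij by (auto simp: is_basis_def lin_indep_def bij_betw_def)
  then obtain C where C: "C \<subseteq> span B" "?S = \<phi> ` C" using subset_imageE by metis
  have "independent C" "span C = span B" using S iff[OF C(1)] C(2) by auto
  then have "|C| =o |B|" using B by (intro bases_equinumerous)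
  moreover have "bij_betw \<phi> C ?S"
    using C bij inj_on_subset by (metis bij_betw_def)
  then have "|?S| =o |C|" using card_of_ordIsoI ordIso_symmetric by blast
  ultimately show ?thesis unfolding vs_dim_def using ordIso_transitive by blast
qed

section \<open>Nullity and corank as cardinals of concrete bases\<close>

lemma nullity_eq_card_basis:
  assumes "Vector_Spaces.linear scale scale f" and K: "independent K" "span K = {v. f v = 0}"
  shows "nullity scale f =o |K|"
  unfolding nullity_def
proof (rule vs_dim_iso[where \<phi> = id])
  interpret f: Vector_Spaces.linear scale scale f by fact
  show "abelian_monoid ((module_of_type scale)\<lparr>carrier := {v. f v = 0}\<rparr>)"
    by (rule abelian_monoidI) (auto simp: module_of_type_def f.add algebra_simps)
qed (auto simp: K module_of_type_def)

text \<open>The last two hypotheses make \<open>span C\<close> a complement of the range, so the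
  quotient map restricts to an isomorphism from it onto the quotient module.\<close>

lemma corank_eq_card_basis:
  fixes f :: "'b \<Rightarrow> 'b"
  assumes f: "Vector_Spaces.linear scale scale f" and C: "independent C"
    and disj: "span C \<inter> range f \<subseteq> {0}" and total: "\<And>v. \<exists>y\<in>range f. v - y \<in> span C"
  shows "corank scale f =o |C|"
proof -
  let ?M = "module_of_type scale" and ?H = "range f"
  let ?Q = "quotient_module ?M ?H"
  interpret f: Vector_Spaces.linear scale scale f by fact
  interpret M: module "ring_of_type_algebra :: 'a ring" ?M
    by (rule module_module_of_type) (rule vector_space_axioms)
  have M: "carrier ?M = UNIV" "\<And>x y. x \<oplus>\<^bsub>?M\<^esub> y = x + y" "\<zero>\<^bsub>?M\<^esub> = 0" "\<And>a x. a \<odot>\<^bsub>?M\<^esub> x = a *s x"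
    by (simp_all add: module_of_type_def)
  have H: "subspace ?H" using f.subspace_image[OF subspace_UNIV] .
  have neg: "\<ominus>\<^bsub>?M\<^esub> x = - x" for x
    using M.minus_equality[of "- x" x] by (simp add: M)
  have sm: "submodule ?H (ring_of_type_algebra :: 'a ring) ?M"
    using H by (intro M.submoduleI) (auto simp: M neg subspace_def intro: subspace_neg[OF H])
  interpret Q: module "ring_of_type_algebra :: 'a ring" ?Q
    by (rule M.quotient_module_is_module[OF sm])
  interpret H: submodule ?H "ring_of_type_algebra :: 'a ring" ?M by (rule sm)
  interpret A: abelian_subgroup ?H ?M
    by (rule abelian_subgroupI3)
       (auto simp: additive_subgroup_def H.subgroup_axioms M.abelian_group_axioms)
  define \<phi> where "\<phi> x = ?H +>\<^bsub>?M\<^esub> x" for x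
  have \<phi>_eq: "\<phi> x = \<phi> y \<longleftrightarrow> x - y \<in> ?H" for x y
  proof -
    have coset: "\<phi> x = {h + x | h. h \<in> ?H}" for x
      by (auto simp: \<phi>_def a_r_coset_def' M)
    show ?thesis
    proof
      assume "\<phi> x = \<phi> y"
      moreover have "x \<in> \<phi> x" using subspace_0[OF H] by (force simp: coset)
      ultimately show "x - y \<in> ?H" by (auto simp: coset)
    next
      assume "x - y \<in> ?H"
      then have "x \<in> \<phi> y" unfolding coset by (intro CollectI exI[of _ "x - y"]) simp
      then show "\<phi> x = \<phi> y" using A.a_repr_independence'[of x y] by (simp add: \<phi>_def M)
    qed
  qed
  show ?thesis
    unfolding corank_def
  proof (rule vs_dim_iso[where \<phi> = \<phi>])
    show "abelian_monoid ?Q" ..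
    show "bij_betw \<phi> (span C) (carrier ?Q)"
      unfolding bij_betw_def
    proof
      \<comment> \<open>Vectors of \<open>span C\<close> in one coset differ by an element of both
        \<open>span C\<close> and the range, hence by zero.\<close>
      show "inj_on \<phi> (span C)"
        using disj span_diff by (fastforce simp: inj_on_def \<phi>_eq)
      have "carrier ?Q = range \<phi>"
        by (auto simp: quotient_module_def A_RCOSETS_def' \<phi>_def M)
      \<comment> \<open>Subtracting the range component of \<open>v\<close> leaves its coset
        unchanged.\<close>
      moreover have "\<phi> v \<in> \<phi> ` span C" for v
      proof -
        obtain y where "y \<in> ?H" "v - y \<in> span C" using total by blast
        then show ?thesis by (intro image_eqI[of _ _ "v - y"]) (auto simp: \<phi>_eq)
      qed
      ultimately show "\<phi> ` span C = carrier ?Q" by auto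
    qed
    show "\<phi> 0 = \<zero>\<^bsub>?Q\<^esub>"
      using M.a_coset_add_zero[of ?H] by (simp add: \<phi>_def M quotient_module_def)
    show "\<phi> (x + y) = \<phi> x \<oplus>\<^bsub>?Q\<^esub> \<phi> y" for x y
      using A.a_rcos_sum[of x y] by (simp add: \<phi>_def quotient_module_def M)
    show "\<phi> (a *s x) = a \<odot>\<^bsub>?Q\<^esub> \<phi> x" for a x
      using M.quotient_smult[OF sm, of a x] by (simp add: \<phi>_def M ring_of_type_algebra_def)
  qed (rule C)
qed

section \<open>Units of the monoid of linear maps\<close>

lemma Units_linear_mapsD:
  assumes "u \<in> Units (linear_maps scale)"
  obtains w where "Vector_Spaces.linear scale scale u" "Vector_Spaces.linear scale scale w" "\<And>v. u (w v) = v" "\<And>v. w (u v) = v"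
  using assms by (auto simp: Units_def linear_maps_def fun_eq_iff)

text \<open>Injectivity supplies a linear left inverse, and surjectivity makes it two-sided.\<close>

lemma bij_linear_Units:
  assumes "Vector_Spaces.linear scale scale u" "bij u"
  shows "u \<in> Units (linear_maps scale)"
proof -
  interpret vector_space_pair scale scale ..
  obtain w where w: "Vector_Spaces.linear scale scale w" "w \<circ> u = id"
    using linear_injective_left_inverse[OF assms(1)] assms(2) bij_is_inj by blast
  have "u (w v) = v" for v
  proof -
    obtain x where x: "v = u x" using bij_is_surj[OF assms(2)] by (rule surjE)
    then show ?thesis using fun_cong[OF w(2), of x] by simp
  qed
  then have "u \<circ> w = id" by (simp add: fun_eq_iff)
  then show ?thesis using w assms by (auto simp: Units_def linear_maps_def)
qed

section \<open>The two implications between unit-regularity and equality of nullity and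
  corank\<close>

lemma nullity_eq_corank_if_unit_regular:
  assumes "unit_regular (linear_maps scale) f"
  shows "nullity scale f =o corank scale f"
proof -
  obtain u where f: "Vector_Spaces.linear scale scale f" and "u \<in> Units (linear_maps scale)"
    and "f \<circ> u \<circ> f = f"
    using assms by (auto simp: unit_regular_def linear_maps_def)
  then have fuf: "f (u (f v)) = f v" for v by (metis comp_apply)
  from \<open>u \<in> Units _\<close> obtain w where u: "Vector_Spaces.linear scale scale u" and w: "Vector_Spaces.linear scale scale w"
    and uw: "\<And>v. u (w v) = v" and wu: "\<And>v. w (u v) = v"
    by (rule Units_linear_mapsD) blast
  interpret f: Vector_Spaces.linear scale scale f by fact
  interpret u: Vector_Spaces.linear scale scale u by fact
  interpret w: Vector_Spaces.linear scale scale w by fact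
  interpret vector_space_pair scale scale ..
  have "subspace {v. f v = 0}" by (rule f.subspace_kernel)
  then obtain K where K: "independent K" "span K = {v. f v = 0}"
    using maximal_independent_subset[of "{v. f v = 0}"] span_subspace by metis
  have inj: "inj w" using uw by (metis injI)
  have span: "span (w ` K) = {v. f (u v) = 0}"
  proof -
    have "span (w ` K) = w ` {v. f v = 0}" by (simp add: w.span_image K)
    also have "\<dots> = {v. f (u v) = 0}"
      using uw wu by (auto intro!: image_eqI[of _ w "u _"])
    finally show ?thesis .
  qed
  have "corank scale f =o |w ` K|"
  proof (rule corank_eq_card_basis[OF f])
    show "independent (w ` K)"
      using w.independent_injective_image[OF K(1)] inj inj_on_subset by blast
    show "span (w ` K) \<inter> range f \<subseteq> {0}" using fuf by (auto simp: span)
    \<comment> \<open>The range component of \<open>v\<close> is its image under the projection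
      given by \<open>f\<close> after \<open>u\<close>, idempotent by \<open>fuf\<close>.\<close>
    show "\<exists>y\<in>range f. v - y \<in> span (w ` K)" for v
      by (rule bexI[of _ "f (u v)"]) (auto simp: span u.diff f.diff fuf)
  qed
  moreover have "|K| =o |w ` K|"
    using inj by (intro card_of_ordIsoI[of w] inj_on_imp_bij_betw) (rule inj_on_subset, auto)
  moreover have "nullity scale f =o |K|" using f K by (rule nullity_eq_card_basis)
  ultimately show ?thesis using ordIso_transitive ordIso_symmetric by meson
qed

lemma unit_regular_if_nullity_eq_corank:
  assumes f: "Vector_Spaces.linear scale scale f" and eq: "nullity scale f =o corank scale f"
  shows "unit_regular (linear_maps scale) f"
proof -
  interpret f: Vector_Spaces.linear scale scale f by fact
  interpret vector_space_pair scale scale ..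
  have R: "subspace (range f)" using f.subspace_image[OF subspace_UNIV] .
  \<comment> \<open>A linear left inverse of the identity on the range, with values in the range, is
    a projection onto it.\<close>
  obtain p where p: "Vector_Spaces.linear scale scale p" "range p \<subseteq> range f" "\<And>y. y \<in> range f \<Longrightarrow> p y = y"
    using linear_exists_left_inverse_on[OF linear_id R] by auto
  obtain g where g: "Vector_Spaces.linear scale scale g" "\<And>y. y \<in> range f \<Longrightarrow> f (g y) = y"
    using linear_exists_right_inverse_on[OF f subspace_UNIV] by auto
  interpret p: Vector_Spaces.linear scale scale p by fact
  interpret g: Vector_Spaces.linear scale scale g by fact
  obtain K where K: "independent K" "span K = {v. f v = 0}"
    using maximal_independent_subset[of "{v. f v = 0}"] span_subspace f.subspace_kernel by metis
  \<comment> \<open>The null space of the projection \<open>p\<close> serves as the complement of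
    the range.\<close>
  obtain C where C: "independent C" "span C = {v. p v = 0}"
    using maximal_independent_subset[of "{v. p v = 0}"] span_subspace p.subspace_kernel by metis
  have pp: "p (p v) = p v" for v using p by blast
  have "corank scale f =o |C|"
  proof (rule corank_eq_card_basis[OF f C(1)])
    show "span C \<inter> range f \<subseteq> {0}" using p(3) by (auto simp: C)
    show "\<exists>y\<in>range f. v - y \<in> span C" for v
      using p(2) by (intro bexI[of _ "p v"]) (auto simp: C p.diff pp)
  qed
  moreover have "nullity scale f =o |K|" using f K by (rule nullity_eq_card_basis)
  ultimately have "|C| =o |K|" using eq ordIso_transitive ordIso_symmetric by meson
  then obtain b where b: "bij_betw b C K" using card_of_ordIso by blast
  \<comment> \<open>The bijection of bases extends linearly; below, \<open>h\<close> is seen to map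
    \<open>span C\<close> isomorphically onto \<open>span K\<close>.\<close>
  obtain h where h: "Vector_Spaces.linear scale scale h" "\<And>c. c \<in> C \<Longrightarrow> h c = b c"
    using linear_independent_extend[OF C(1)] by metis
  interpret h: Vector_Spaces.linear scale scale h by fact
  have hb: "bij_betw h C K" using b h(2) bij_betw_cong by metis
  then have hC: "h ` C = K" by (rule bij_betw_imp_surj_on)
  have h_img: "h ` span C = span K" by (simp add: h.span_image[symmetric] hC)
  have h_inj: "inj_on h (span C)"
    using h.inj_on_span_independent_image[of C] K(1) hC hb bij_betw_imp_inj_on by metis
  define u where "u v = g (p v) + h (v - p v)" for v
  have u: "Vector_Spaces.linear scale scale u"
    unfolding u_def Vector_Spaces.linear_iff
    by (simp add: p.add g.add h.add p.scale g.scale h.scale h.diff vector_space_axioms algebra_simps)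
  interpret u: Vector_Spaces.linear scale scale u by fact
  have rest: "v - p v \<in> span C" for v by (simp add: C p.diff pp)
  \<comment> \<open>\<open>f\<close> kills the \<open>h\<close> summand, which lies in its null
    space, and undoes \<open>g\<close> on the range.\<close>
  have fu: "f (u v) = p v" for v
  proof -
    have "h (v - p v) \<in> span K" using rest h_img by blast
    moreover have "f (g (p v)) = p v" using p(2) by (intro g(2)) auto
    ultimately show ?thesis by (simp add: u_def f.add K)
  qed
  have "inj u"
    unfolding u.inj_iff_eq_0
  proof (intro allI impI)
    \<comment> \<open>Applying \<open>f\<close> to \<open>u v = 0\<close> removes the range
      component of \<open>v\<close>; injectivity of \<open>h\<close> on \<open>span C\<close>
      removes the rest.\<close>
    fix v assume v: "u v = 0"
    then have "p v = 0" using fu[of v] by simp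
    moreover from this v have "h v = 0" by (simp add: u_def)
    ultimately show "v = 0" using inj_onD[OF h_inj, of v 0] span_zero by (simp add: C)
  qed
  moreover have "surj u"
    unfolding surj_def
  proof
    fix v
    \<comment> \<open>To find a preimage of \<open>v\<close>, note that \<open>g (f v)\<close> is
      the value of \<open>u\<close> at \<open>f v\<close>; the remainder lies in the null space of
      \<open>f\<close>, hence is \<open>h s\<close> for some \<open>s\<close> killed by
      \<open>p\<close>. This suggests \<open>f v + s\<close>.\<close>
    have "v - g (f v) \<in> span K" by (simp add: K f.diff g(2))
    then obtain s where s: "s \<in> span C" "v - g (f v) = h s" using h_img by blast
    then have "p (f v + s) = f v" by (simp add: p.add p(3) C)
    then have "u (f v + s) = v" using s by (simp add: u_def flip: s(2))
    then show "\<exists>x. v = u x" by metis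
  qed
  \<comment> \<open>By \<open>fu\<close>, \<open>f\<close> after \<open>u\<close> is
    \<open>p\<close>, which fixes the range of \<open>f\<close>.\<close>
  moreover have "f \<circ> u \<circ> f = f" using fu p(3) by (auto simp: fun_eq_iff)
  ultimately show ?thesis
    using f bij_linear_Units[OF u] unfolding unit_regular_def bij_def
    by (auto simp: linear_maps_def)
qed

end

theorem corollary4p7:
  fixes scale :: "'k :: field \<Rightarrow> 'v :: ab_group_add \<Rightarrow> 'v" and f :: "'v \<Rightarrow> 'v"
  assumes "vector_space scale"
    and "f \<in> carrier (linear_maps scale)"
  shows "unit_regular (linear_maps scale) f \<longleftrightarrow> nullity scale f =o corank scale f"
proof -
  interpret vector_space scale by fact
  show ?thesis
    using nullity_eq_corank_if_unit_regular unit_regular_if_nullity_eq_corank assms(2)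
    by (auto simp: linear_maps_def)
qed

end
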